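(* Let $X$ be a set with $|X|\geq2$, and let $\mathcal{PB}_X$ be the partial Brauer monoid over $X$. Then $\mathcal{PB}_X$ is not $E$-Ehresmann with respect to the semilattice $E=E(\mathcal{I}_X)=\{\mathrm{id}_A:A\subseteq X\}$.
   Context: Partition monoid: let $X$ be a set and $X'=\{x':x\in X\}$ a disjoint copy of $X$. $\mathcal{P}_X$ is the set of all set partitions of $X\cup X'$. Given $\alpha,\beta\in\mathcal{P}_X$, let $X''=\{x'':x\in X\}$ be another disjoint copy; represent $\alpha$ and $\beta$ by graphs on $X\cup X'$ whose connected components are the blocks; rename each lower vertex $x'$ of $\alpha$ to $x''$ and each upper vertex $x$ of $\beta$ to $x''$; take the union of these graphs on $X\cup X''\cup X'$. The product $\alpha\beta$ is the partition of $X\cup X'$ in which two elements lie in the same block iff they are joined by a path in this union graph. This makes $\mathcal{P}_X$ a monoid. The partial Brauer monoid $\mathcal{PB}_X$ is the submonoid of all $\alpha\in\mathcal{P}_X$ each of whose blocks has size at most $2$. For $A\subseteq X$, $\mathrm{id}_A=\{\{a,a'\}:a\in A\}\cup\{\{x\},\{x'\}:x\in X\setminus A\}\in\mathcal{PB}_X$; these are exactly the idempotents of the symmetric inverse monoid $\mathcal{I}_X$, realised in $\mathcal{P}_X$ as the submonoid of all partitions in which no two elements of $X$, and no two elements of $X'$, lie in a common block. One has $\mathrm{id}_A\mathrm{id}_B=\mathrm{id}_{A\cap B}$. Ehresmann semigroups: let $S$ be a semigroup and $E\subseteq S$ a semilattice (a commutative subsemigroup consisting of idempotents). For $x\in S$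 let $E_L(x)=\{e\in E:x=ex\}$ and $E_R(x)=\{e\in E:x=xe\}$. Define $x\,\mathscr{R}^E\,y\iff E_L(x)=E_L(y)$ and $x\,\mathscr{L}^E\,y\iff E_R(x)=E_R(y)$. $S$ is left $E$-Ehresmann if every $\mathscr{R}^E$-class contains precisely one element of $E$ and $\mathscr{R}^E$ is a left congruence ($x\,\mathscr{R}^E\,y\Rightarrow ax\,\mathscr{R}^E\,ay$). $S$ is right $E$-Ehresmann if every $\mathscr{L}^E$-class contains precisely one element of $E$ and $\mathscr{L}^E$ is a right congruence ($x\,\mathscr{L}^E\,y\Rightarrow xa\,\mathscr{L}^E\,ya$). $S$ is $E$-Ehresmann if it is both left and right $E$-Ehresmann. *)

theory Defs
  imports "HOL-Algebra.Group" "HOL-Library.Disjoint_Sets"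
begin

section \<open>Ehresmann semigroups\<close>

text \<open>
  Semigroups are given by the \<open>carrier\<close> and \<open>mult\<close> fields of a \<open>monoid\<close> record.
  The notions \<open>left_Ehresmann\<close>, \<open>right_Ehresmann\<close> and \<open>Ehresmann\<close> are meant for a semigroup
  \<open>S\<close> and a semilattice \<open>E\<close> in \<open>S\<close>.  These standing assumptions are not conjuncts of the
  definitions, so that the negation of \<open>Ehresmann\<close> cannot hold merely because one of them fails.
\<close>

definition idempotents :: "('s, 'm) monoid_scheme \<Rightarrow> 's set" where
  "idempotents S = {e \<in> carrier S. e \<otimes>\<^bsub>S\<^esub> e = e}"

definition semilattice_in :: "('s, 'm) monoid_scheme \<Rightarrow> 's set \<Rightarrow> bool" where
  "semilattice_in S E \<longleftrightarrow> E \<subseteq> idempotents S \<and>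
     (\<forall>e\<in>E. \<forall>f\<in>E. e \<otimes>\<^bsub>S\<^esub> f \<in> E \<and> e \<otimes>\<^bsub>S\<^esub> f = f \<otimes>\<^bsub>S\<^esub> e)"

definition left_identities :: "('s, 'm) monoid_scheme \<Rightarrow> 's set \<Rightarrow> 's \<Rightarrow> 's set" where
  "left_identities S E x = {e \<in> E. x = e \<otimes>\<^bsub>S\<^esub> x}"

definition right_identities :: "('s, 'm) monoid_scheme \<Rightarrow> 's set \<Rightarrow> 's \<Rightarrow> 's set" where
  "right_identities S E x = {e \<in> E. x = x \<otimes>\<^bsub>S\<^esub> e}"

definition R_rel :: "('s, 'm) monoid_scheme \<Rightarrow> 's set \<Rightarrow> 's rel" where
  "R_rel S E = {(x, y) \<in> carrier S \<times> carrier S. left_identities S E x = left_identities S E y}"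

definition L_rel :: "('s, 'm) monoid_scheme \<Rightarrow> 's set \<Rightarrow> 's rel" where
  "L_rel S E = {(x, y) \<in> carrier S \<times> carrier S. right_identities S E x = right_identities S E y}"

definition left_Ehresmann :: "('s, 'm) monoid_scheme \<Rightarrow> 's set \<Rightarrow> bool" where
  "left_Ehresmann S E \<longleftrightarrow>
     (\<forall>C \<in> carrier S // R_rel S E. \<exists>!e. e \<in> C \<inter> E) \<and>
     (\<forall>a \<in> carrier S. \<forall>(x, y) \<in> R_rel S E. (a \<otimes>\<^bsub>S\<^esub> x, a \<otimes>\<^bsub>S\<^esub> y) \<in> R_rel S E)"

definition right_Ehresmann :: "('s, 'm) monoid_scheme \<Rightarrow> 's set \<Rightarrow> bool" where
  "right_Ehresmann S E \<longleftrightarrow>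
     (\<forall>C \<in> carrier S // L_rel S E. \<exists>!e. e \<in> C \<inter> E) \<and>
     (\<forall>a \<in> carrier S. \<forall>(x, y) \<in> L_rel S E. (x \<otimes>\<^bsub>S\<^esub> a, y \<otimes>\<^bsub>S\<^esub> a) \<in> L_rel S E)"

definition Ehresmann :: "('s, 'm) monoid_scheme \<Rightarrow> 's set \<Rightarrow> bool" where
  "Ehresmann S E \<longleftrightarrow> left_Ehresmann S E \<and> right_Ehresmann S E"


section \<open>The partition monoid\<close>

text \<open>The upper vertex \<open>x\<close> is \<open>Inl x\<close> and the lower vertex \<open>x'\<close> is \<open>Inr x\<close>.\<close>

definition points :: "'a set \<Rightarrow> ('a + 'a) set" where
  "points X = Inl ` X \<union> Inr ` X"

text \<open>
  Vertices of the product graph: \<open>Upper x\<close>, \<open>Middle x\<close>, \<open>Lower x\<close> stand for \<open>x\<close>, \<open>x''\<close>, \<open>x'\<close>.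
\<close>

datatype 'a vertex = Upper 'a | Middle 'a | Lower 'a

text \<open>
  The three ways a vertex of \<open>points X\<close> enters the product graph: as a vertex of the first factor,
  as a vertex of the second factor, and as a vertex of the product.
\<close>

fun in_first :: "'a + 'a \<Rightarrow> 'a vertex" where
  "in_first (Inl x) = Upper x"
| "in_first (Inr x) = Middle x"

fun in_second :: "'a + 'a \<Rightarrow> 'a vertex" where
  "in_second (Inl x) = Middle x"
| "in_second (Inr x) = Lower x"

fun in_product :: "'a + 'a \<Rightarrow> 'a vertex" where
  "in_product (Inl x) = Upper x"
| "in_product (Inr x) = Lower x"

text \<open>
  Each factor is represented by the graph in which any two vertices of a common block are adjacent
  (so its components are the blocks).  The edge relation is symmetric, hence being joined by a path
  is its reflexive transitive closure.
\<close>

definition product_edges ::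
  "('a + 'a) set set \<Rightarrow> ('a + 'a) set set \<Rightarrow> 'a vertex rel" where
  "product_edges \<alpha> \<beta> =
     {(in_first u, in_first v) | u v. \<exists>B\<in>\<alpha>. u \<in> B \<and> v \<in> B} \<union>
     {(in_second u, in_second v) | u v. \<exists>B\<in>\<beta>. u \<in> B \<and> v \<in> B}"

definition partition_product ::
  "'a set \<Rightarrow> ('a + 'a) set set \<Rightarrow> ('a + 'a) set set \<Rightarrow> ('a + 'a) set set" where
  "partition_product X \<alpha> \<beta> =
     points X // {(u, v) \<in> points X \<times> points X.
                    (in_product u, in_product v) \<in> (product_edges \<alpha> \<beta>)\<^sup>*}"

definition partial_id :: "'a set \<Rightarrow> 'a set \<Rightarrow> ('a + 'a) set set" where
  "partial_id X A =
     {{Inl a, Inr a} | a. a \<in> A} \<union> {{Inl x} | x. x \<in> X - A} \<union> {{Inr x} | x. x \<in> X - A}"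

definition partition_monoid :: "'a set \<Rightarrow> ('a + 'a) set set monoid" where
  "partition_monoid X =
     \<lparr>carrier = {\<alpha>. partition_on (points X) \<alpha>},
      mult = partition_product X,
      one = partial_id X X\<rparr>"

definition partial_Brauer_monoid :: "'a set \<Rightarrow> ('a + 'a) set set monoid" where
  "partial_Brauer_monoid X = (partition_monoid X)
     \<lparr>carrier := {\<alpha> \<in> carrier (partition_monoid X). \<forall>B\<in>\<alpha>. finite B \<and> card B \<le> 2}\<rparr>"

definition symmetric_inverse_monoid :: "'a set \<Rightarrow> ('a + 'a) set set monoid" where
  "symmetric_inverse_monoid X = (partition_monoid X)
     \<lparr>carrier := {\<alpha> \<in> carrier (partition_monoid X). \<forall>B\<in>\<alpha>. \<forall>x y.
        (Inl x \<in> B \<and> Inl y \<in> B \<longrightarrow> x = y) \<and> (Inr x \<in> B \<and> Inr y \<in> B \<longrightarrow> x = y)}\<rparr>"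

end

theory Submission
  imports Defs
begin

text \<open>
  Left multiplication by \<open>partial_id X A\<close> isolates the upper vertices outside \<open>A\<close> and leaves the
  rest of the partition alone.  So \<open>partial_id X A\<close> is a left identity of \<open>\<beta>\<close> exactly
  when every upper vertex outside \<open>A\<close> is a singleton block of \<open>\<beta>\<close>.  This is insensitive to the
  nature of the nontrivial blocks at the upper vertices: for distinct \<open>p\<close> and \<open>q\<close> the partition
  \<open>cap X p q\<close>, whose only nontrivial block joins the upper vertices \<open>p\<close> and \<open>q\<close>, is
  \<open>\<R>\<close>-related to \<open>partial_id X {p, q}\<close>.  Multiply both on the left by \<open>partial_id X {p}\<close>.
  Isolating \<open>q\<close> destroys the whole block of \<open>cap X p q\<close>, and the product is \<open>partial_id X {}\<close>;
  but it only destroys one of the two nontrivial blocks of \<open>partial_id X {p, q}\<close>, and the product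
  is \<open>partial_id X {p}\<close>.  Distinct elements of \<open>E\<close> are never \<open>\<R>\<close>-related here, so \<open>\<R>\<close> is not a left
  congruence.  All these products are instances of \<open>partial_id_product\<close>.

  That the idempotents of the symmetric inverse monoid are the partial identities is the fact
  that an idempotent injective partial map \<open>f\<close> is the identity on its domain
  (\<open>f (f x) = f x\<close> gives \<open>f x = x\<close>).
\<close>

section \<open>Partitions as equivalence relations\<close>

definition same_block :: "'b set set \<Rightarrow> 'b rel" where
  "same_block P = {(u, v). \<exists>B\<in>P. u \<in> B \<and> v \<in> B}"

lemma quotient_same_block:
  assumes "partition_on A P"
  shows "A // same_block P = P"
  using partition_on_eq_quotient[OF assms] by (simp add: same_block_def)

lemma partition_eqI:
  assumes "partition_on A P" "partition_on A Q" "same_block P = same_block Q"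
  shows "P = Q"
  using assms quotient_same_block by metis

lemma same_block_trans:
  assumes "partition_on A P" "(u, v) \<in> same_block P" "(v, w) \<in> same_block P"
  shows "(u, w) \<in> same_block P"
proof -
  obtain B C where "B \<in> P" "u \<in> B" "v \<in> B" "C \<in> P" "v \<in> C" "w \<in> C"
    using assms(2,3) by (auto simp: same_block_def)
  moreover from this have "B = C"
    using assms(1) by (auto simp: partition_on_def disjoint_def)
  ultimately show ?thesis by (auto simp: same_block_def)
qed

lemma same_block_sym: "(u, v) \<in> same_block P \<Longrightarrow> (v, u) \<in> same_block P"
  by (auto simp: same_block_def)

lemma same_block_in:
  assumes "partition_on A P" "(u, v) \<in> same_block P"
  shows "u \<in> A" "v \<in> A"
  using assms by (auto simp: partition_on_def same_block_def)

lemma same_block_refl: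
  assumes "partition_on A P" "u \<in> A"
  shows "(u, u) \<in> same_block P"
  using assms by (auto simp: partition_on_def same_block_def)

lemma product_edges_same_block:
  "product_edges \<alpha> \<beta> = {(in_first u, in_first v) | u v. (u, v) \<in> same_block \<alpha>} \<union>
     {(in_second u, in_second v) | u v. (u, v) \<in> same_block \<beta>}"
  by (simp add: product_edges_def same_block_def)

lemma product_edges_first:
  "(u, v) \<in> same_block \<alpha> \<Longrightarrow> (in_first u, in_first v) \<in> product_edges \<alpha> \<beta>"
  unfolding product_edges_same_block by blast

lemma product_edges_second:
  "(u, v) \<in> same_block \<beta> \<Longrightarrow> (in_second u, in_second v) \<in> product_edges \<alpha> \<beta>"
  unfolding product_edges_same_block by blast

lemma sym_product_edges: "sym (product_edges \<alpha> \<beta>)"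
  unfolding product_edges_def by (rule symI) blast

lemma partition_product_eqI:
  assumes "partition_on (points X) \<gamma>"
    and "\<And>u v. u \<in> points X \<Longrightarrow> v \<in> points X \<Longrightarrow>
      (in_product u, in_product v) \<in> (product_edges \<alpha> \<beta>)\<^sup>* \<longleftrightarrow> (u, v) \<in> same_block \<gamma>"
  shows "partition_product X \<alpha> \<beta> = \<gamma>"
proof -
  have "{(u, v) \<in> points X \<times> points X. (in_product u, in_product v) \<in> (product_edges \<alpha> \<beta>)\<^sup>*}
    = same_block \<gamma>"
    using assms(2) same_block_in[OF assms(1)] by auto
  then show ?thesis
    by (simp add: partition_product_def quotient_same_block[OF assms(1)])
qed

section \<open>Partial identities\<close>

lemma partition_on_partial_id:
  assumes "A \<subseteq> X"
  shows "partition_on (points X) (partial_id X A)"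
proof (rule partition_onI)
  show "\<Union> (partial_id X A) = points X"
  proof
    show "\<Union> (partial_id X A) \<subseteq> points X"
      using assms by (auto simp: partial_id_def points_def)
    have "\<exists>B \<in> partial_id X A. Inl x \<in> B" "\<exists>B \<in> partial_id X A. Inr x \<in> B" if "x \<in> X" for x
      unfolding partial_id_def using that by (cases "x \<in> A"; blast)+
    then show "points X \<subseteq> \<Union> (partial_id X A)"
      by (auto simp: points_def)
  qed
  show "disjnt p q" if "p \<in> partial_id X A" "q \<in> partial_id X A" "p \<noteq> q" for p q
    using that by (auto simp: partial_id_def disjnt_def)
  show "{} \<notin> partial_id X A"
    by (auto simp: partial_id_def)
qed

lemma same_block_partial_id:
  assumes "A \<subseteq> X"
  shows "(u, v) \<in> same_block (partial_id X A) \<longleftrightarrow>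
    u \<in> points X \<and> v \<in> points X \<and> (u = v \<or> (\<exists>a\<in>A. u \<in> {Inl a, Inr a} \<and> v \<in> {Inl a, Inr a}))"
  (is "?l \<longleftrightarrow> ?r")
proof
  show "?l \<Longrightarrow> ?r"
    using assms by (auto simp: same_block_def partial_id_def points_def)
next
  assume r: ?r
  show ?l
  proof (cases "u = v")
    case True
    then show ?thesis using r same_block_refl[OF partition_on_partial_id[OF assms]] by simp
  next
    case False
    with r obtain a where a: "a \<in> A" "u \<in> {Inl a, Inr a}" "v \<in> {Inl a, Inr a}" by blast
    then have "{Inl a, Inr a} \<in> partial_id X A" by (auto simp: partial_id_def)
    with a(2,3) show ?thesis unfolding same_block_def by (auto intro!: bexI[of _ "{Inl a, Inr a}"])
  qed
qed

lemma partial_id_eq_iff: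
  assumes "A \<subseteq> X" "B \<subseteq> X"
  shows "partial_id X A = partial_id X B \<longleftrightarrow> A = B"
proof
  have mem: "a \<in> C \<longleftrightarrow> (Inl a, Inr a) \<in> same_block (partial_id X C)" if "C \<subseteq> X" for a C
    using that by (auto simp: same_block_partial_id points_def)
  show "A = B" if eq: "partial_id X A = partial_id X B"
  proof (rule Set.set_eqI)
    show "a \<in> A \<longleftrightarrow> a \<in> B" for a
      unfolding mem[OF assms(1)] mem[OF assms(2)] eq ..
  qed
qed simp

text \<open>
  The vertex of \<open>\<beta>\<close> to which a vertex of the graph of \<open>partial_id X A\<close> times \<open>\<beta>\<close> is attached:
  an upper vertex outside \<open>A\<close> is isolated in that graph, and an upper vertex \<open>x\<close> in \<open>A\<close> is adjacent
  to \<open>x''\<close>.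
\<close>

fun attached :: "'a set \<Rightarrow> 'a vertex \<Rightarrow> ('a + 'a) set" where
  "attached A (Upper x) = (if x \<in> A then {Inl x} else {})"
| "attached A (Middle x) = {Inl x}"
| "attached A (Lower x) = {Inr x}"

text \<open>
  Collapsing each edge between \<open>x\<close> and \<open>x''\<close> turns the product graph into the graph of \<open>\<beta>\<close> together
  with isolated upper vertices, so paths can be read off from the blocks of \<open>\<beta>\<close>.
\<close>

lemma partial_id_path_iff:
  assumes A: "A \<subseteq> X" and \<beta>: "partition_on (points X) \<beta>"
  shows "(in_product u, in_product v) \<in> (product_edges (partial_id X A) \<beta>)\<^sup>* \<longleftrightarrow>
    u = v \<or> (u, v) \<in> same_block \<beta> \<and> u \<notin> Inl ` (- A) \<and> v \<notin> Inl ` (- A)"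
    (is "(_, _) \<in> ?E\<^sup>* \<longleftrightarrow> ?r")
proof
  define joined where "joined s t \<longleftrightarrow>
    s = t \<or> (\<exists>a \<in> attached A s. \<exists>b \<in> attached A t. (a, b) \<in> same_block \<beta>)" for s t
  have edge: "joined s t" if "(s, t) \<in> ?E" for s t
    using that unfolding product_edges_same_block
  proof (elim UnE CollectE exE conjE)
    fix a b assume e: "(s, t) = (in_first a, in_first b)" "(a, b) \<in> same_block (partial_id X A)"
    show "joined s t"
    proof (cases "a = b")
      case False
      with e obtain c where c: "c \<in> A" "a \<in> {Inl c, Inr c}" "b \<in> {Inl c, Inr c}"
        by (auto simp: same_block_partial_id[OF A])
      then have "(Inl c, Inl c) \<in> same_block \<beta>"
        using A by (auto intro!: same_block_refl[OF \<beta>] simp: points_def)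
      then show ?thesis using c e(1) by (auto simp: joined_def)
    qed (use e in \<open>simp add: joined_def\<close>)
  next
    fix a b assume e: "(s, t) = (in_second a, in_second b)" "(a, b) \<in> same_block \<beta>"
    have "attached A (in_second c) = {c}" for c by (cases c) auto
    then show "joined s t" using e by (auto simp: joined_def)
  qed
  have single: "a = b" if "a \<in> attached A t" "b \<in> attached A t" for a b t
    using that by (cases t) (auto split: if_splits)
  have trans: "joined s t'" if "joined s t" "joined t t'" for s t t'
    using that single same_block_trans[OF \<beta>] unfolding joined_def by metis
  assume "(in_product u, in_product v) \<in> ?E\<^sup>*"
  then have "joined (in_product u) (in_product v)"
  proof (induction rule: rtrancl_induct)
    case base
    show ?case by (simp add: joined_def)
  next
    case (step s t)
    then show ?case using trans edge by blast
  qed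
  then show ?r
    by (cases u; cases v) (auto simp: joined_def split: if_splits)
next
  assume r: ?r
  show "(in_product u, in_product v) \<in> ?E\<^sup>*"
  proof (cases "u = v")
    case False
    with r have uv: "(u, v) \<in> same_block \<beta>" "u \<notin> Inl ` (- A)" "v \<notin> Inl ` (- A)" by auto
    have down: "(in_product w, in_second w) \<in> ?E\<^sup>* \<and> (in_second w, in_product w) \<in> ?E\<^sup>*"
      if w: "w \<notin> Inl ` (- A)" for w
    proof (cases w)
      case (Inl x)
      with w have "x \<in> A" by auto
      then have "(Inl x, Inr x) \<in> same_block (partial_id X A)"
        using A by (auto simp: same_block_partial_id points_def)
      then have "(in_first (Inl x), in_first (Inr x)) \<in> ?E" "(in_first (Inr x), in_first (Inl x)) \<in> ?E"
        using same_block_sym product_edges_first by metis+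
      then show ?thesis by (auto simp: Inl)
    qed simp
    have "(in_second u, in_second v) \<in> ?E"
      using uv(1) by (rule product_edges_second)
    then show ?thesis
      using down[OF uv(2)] down[OF uv(3)] by (meson rtrancl.rtrancl_into_rtrancl rtrancl_trans)
  qed simp
qed

lemma partial_id_product:
  assumes "A \<subseteq> X" "partition_on (points X) \<beta>" "partition_on (points X) \<gamma>"
    and "\<And>u v. u \<in> points X \<Longrightarrow> v \<in> points X \<Longrightarrow> u \<noteq> v \<Longrightarrow> (u, v) \<in> same_block \<gamma> \<longleftrightarrow>
      (u, v) \<in> same_block \<beta> \<and> u \<notin> Inl ` (- A) \<and> v \<notin> Inl ` (- A)"
  shows "partition_product X (partial_id X A) \<beta> = \<gamma>"
proof (rule partition_product_eqI[OF assms(3)])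
  fix u v assume "u \<in> points X" "v \<in> points X"
  then show "(in_product u, in_product v) \<in> (product_edges (partial_id X A) \<beta>)\<^sup>* \<longleftrightarrow>
      (u, v) \<in> same_block \<gamma>"
    using partial_id_path_iff[OF assms(1,2)] assms(4) same_block_refl[OF assms(3)] by metis
qed

lemma partial_id_mult:
  assumes "A \<subseteq> X" "B \<subseteq> X"
  shows "partition_product X (partial_id X A) (partial_id X B) = partial_id X (A \<inter> B)"
proof -
  have "A \<inter> B \<subseteq> X" using assms by blast
  then show ?thesis
    using assms by (intro partial_id_product) (auto simp: partition_on_partial_id same_block_partial_id)
qed

section \<open>Idempotents of the symmetric inverse monoid\<close>

text \<open>
  In the product graph of \<open>\<alpha>\<close> with itself, the path that starts at the upper vertex \<open>x\<close> follows the
  injective partial map given by \<open>\<alpha>\<close> twice.  As the square is \<open>\<alpha>\<close> again, it must end in \<open>y'\<close>, so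
  that the map fixes \<open>y\<close>; since it also sends \<open>x\<close> to \<open>y\<close>, injectivity gives \<open>x = y\<close>.
\<close>

lemma idempotent_transversal:
  assumes \<alpha>: "partition_on (points X) \<alpha>" and idem: "partition_product X \<alpha> \<alpha> = \<alpha>"
    and upper: "\<And>a b. (Inl a, Inl b) \<in> same_block \<alpha> \<Longrightarrow> a = b"
    and lower: "\<And>a b. (Inr a, Inr b) \<in> same_block \<alpha> \<Longrightarrow> a = b"
    and xy: "(Inl x, Inr y) \<in> same_block \<alpha>"
  shows "x = y"
proof -
  define component where
    "component = {Upper x, Middle y} \<union> {Lower z | z. (Inl y, Inr z) \<in> same_block \<alpha>}"
  have uniq: "w = Inl a \<or> w = Inr b" if "(Inl a, Inr b) \<in> same_block \<alpha>"
    "(Inl a, w) \<in> same_block \<alpha> \<or> (Inr b, w) \<in> same_block \<alpha>" for a b w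
  proof -
    have "(Inl a, w) \<in> same_block \<alpha>" "(Inr b, w) \<in> same_block \<alpha>"
      using that same_block_trans[OF \<alpha>] same_block_sym by metis+
    then show ?thesis using upper lower by (cases w) blast+
  qed
  have closed: "t \<in> component" if "(s, t) \<in> product_edges \<alpha> \<alpha>" "s \<in> component" for s t
    using that(1) unfolding product_edges_same_block
  proof (elim UnE CollectE exE conjE)
    fix a b assume e: "(s, t) = (in_first a, in_first b)" "(a, b) \<in> same_block \<alpha>"
    then have "a = Inl x \<or> a = Inr y"
      using that(2) by (cases a) (auto simp: component_def)
    with e have "b = Inl x \<or> b = Inr y" using uniq[OF xy] by blast
    then show "t \<in> component" using e by (auto simp: component_def)
  next
    fix a b assume e: "(s, t) = (in_second a, in_second b)" "(a, b) \<in> same_block \<alpha>"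
    then have "(Inl y, a) \<in> same_block \<alpha> \<or> a = Inl y"
      using that(2) by (cases a) (auto simp: component_def)
    with e have yb: "(Inl y, b) \<in> same_block \<alpha>" using same_block_trans[OF \<alpha>] by blast
    then show "t \<in> component" using e upper[of y] by (cases b) (auto simp: component_def)
  qed
  have "points X // {(u, v) \<in> points X \<times> points X.
      (in_product u, in_product v) \<in> (product_edges \<alpha> \<alpha>)\<^sup>*} = \<alpha>"
    using idem by (simp add: partition_product_def)
  moreover obtain B where B: "B \<in> \<alpha>" "Inl x \<in> B" "Inr y \<in> B"
    using xy by (auto simp: same_block_def)
  ultimately have "B \<in> points X // {(u, v) \<in> points X \<times> points X.
      (in_product u, in_product v) \<in> (product_edges \<alpha> \<alpha>)\<^sup>*}"
    by simp
  then obtain w where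
    "B = {(u, v) \<in> points X \<times> points X. (in_product u, in_product v) \<in> (product_edges \<alpha> \<alpha>)\<^sup>*} `` {w}"
    by (rule quotientE)
  then have w: "(in_product w, Upper x) \<in> (product_edges \<alpha> \<alpha>)\<^sup>*"
    "(in_product w, Lower y) \<in> (product_edges \<alpha> \<alpha>)\<^sup>*"
    using B(2,3) by simp_all
  have "(Upper x, in_product w) \<in> (product_edges \<alpha> \<alpha>)\<^sup>*"
    using w(1) sym_rtrancl[OF sym_product_edges] by (rule symD[rotated])
  then have "(Upper x, Lower y) \<in> (product_edges \<alpha> \<alpha>)\<^sup>*"
    using w(2) by (rule rtrancl_trans)
  then have "Lower y \<in> component"
  proof (induction rule: rtrancl_induct)
    case base
    show ?case by (simp add: component_def)
  next
    case (step s t)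
    then show ?case using closed by blast
  qed
  then have "(Inl y, Inr y) \<in> same_block \<alpha>" by (simp add: component_def)
  then show ?thesis
    using xy upper same_block_sym same_block_trans[OF \<alpha>] by metis
qed

lemma idempotents_symmetric_inverse_monoid:
  "idempotents (symmetric_inverse_monoid X) = {partial_id X A | A. A \<subseteq> X}"
proof (intro equalityI subsetI)
  fix \<alpha> assume "\<alpha> \<in> idempotents (symmetric_inverse_monoid X)"
  then have \<alpha>: "partition_on (points X) \<alpha>" and idem: "partition_product X \<alpha> \<alpha> = \<alpha>"
    and inj: "\<forall>B\<in>\<alpha>. \<forall>x y. (Inl x \<in> B \<and> Inl y \<in> B \<longrightarrow> x = y) \<and> (Inr x \<in> B \<and> Inr y \<in> B \<longrightarrow> x = y)"
    by (auto simp: idempotents_def symmetric_inverse_monoid_def partition_monoid_def)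
  have upper: "a = b" if "(Inl a, Inl b) \<in> same_block \<alpha>" for a b
    using that inj by (auto simp: same_block_def)
  have lower: "a = b" if "(Inr a, Inr b) \<in> same_block \<alpha>" for a b
    using that inj by (auto simp: same_block_def)
  note fixed = idempotent_transversal[OF \<alpha> idem upper lower]
  define A where "A = {a. (Inl a, Inr a) \<in> same_block \<alpha>}"
  have A: "A \<subseteq> X" using same_block_in(1)[OF \<alpha>] by (auto simp: A_def points_def)
  have "(u, v) \<in> same_block \<alpha> \<longleftrightarrow> (u, v) \<in> same_block (partial_id X A)" for u v
  proof
    assume uv: "(u, v) \<in> same_block \<alpha>"
    then have "u = v \<or> (\<exists>a\<in>A. u \<in> {Inl a, Inr a} \<and> v \<in> {Inl a, Inr a})"
      using upper lower fixed same_block_sym[OF uv] by (cases u; cases v) (fastforce simp: A_def)+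
    then show "(u, v) \<in> same_block (partial_id X A)"
      using same_block_in[OF \<alpha> uv] by (simp add: same_block_partial_id[OF A])
  next
    assume uv: "(u, v) \<in> same_block (partial_id X A)"
    show "(u, v) \<in> same_block \<alpha>"
    proof (cases "u = v")
      case True
      then show ?thesis using uv same_block_refl[OF \<alpha>] by (simp add: same_block_partial_id[OF A])
    next
      case False
      with uv obtain a where "a \<in> A" "u \<in> {Inl a, Inr a}" "v \<in> {Inl a, Inr a}"
        by (auto simp: same_block_partial_id[OF A])
      then show ?thesis using False same_block_sym by (auto simp: A_def)
    qed
  qed
  then have "\<alpha> = partial_id X A"
    by (intro partition_eqI[OF \<alpha> partition_on_partial_id[OF A]]) auto
  with A show "\<alpha> \<in> {partial_id X A | A. A \<subseteq> X}" by blast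
next
  fix \<alpha> assume "\<alpha> \<in> {partial_id X A | A. A \<subseteq> X}"
  then obtain A where "A \<subseteq> X" "\<alpha> = partial_id X A" by blast
  then show "\<alpha> \<in> idempotents (symmetric_inverse_monoid X)"
    using partition_on_partial_id[of A X] partial_id_mult[of A X A]
    by (auto simp: idempotents_def symmetric_inverse_monoid_def partition_monoid_def partial_id_def)
qed

section \<open>The partial Brauer monoid\<close>

lemma partial_Brauer_monoid_simps:
  "\<alpha> \<otimes>\<^bsub>partial_Brauer_monoid X\<^esub> \<beta> = partition_product X \<alpha> \<beta>"
  "\<alpha> \<in> carrier (partial_Brauer_monoid X) \<longleftrightarrow>
    partition_on (points X) \<alpha> \<and> (\<forall>B\<in>\<alpha>. finite B \<and> card B \<le> 2)"
  by (simp_all add: partial_Brauer_monoid_def partition_monoid_def)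

lemma partial_id_in_partial_Brauer_monoid:
  assumes "A \<subseteq> X"
  shows "partial_id X A \<in> carrier (partial_Brauer_monoid X)"
  using partition_on_partial_id[OF assms]
  by (auto simp: partial_Brauer_monoid_simps partial_id_def)

lemma semilattice_in_partial_Brauer_monoid:
  "semilattice_in (partial_Brauer_monoid X) {partial_id X A | A. A \<subseteq> X}"
  unfolding semilattice_in_def idempotents_def
  by (auto simp: partial_id_in_partial_Brauer_monoid partial_Brauer_monoid_simps(1) partial_id_mult
      Int_commute)

definition cap :: "'a set \<Rightarrow> 'a \<Rightarrow> 'a \<Rightarrow> ('a + 'a) set set" where
  "cap X p q = insert {Inl p, Inl q} {{u} | u. u \<in> points X - {Inl p, Inl q}}"

lemma partition_on_cap:
  assumes "p \<in> X" "q \<in> X"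
  shows "partition_on (points X) (cap X p q)"
proof (rule partition_onI)
  show "\<Union> (cap X p q) = points X"
    using assms by (auto simp: cap_def points_def)
qed (auto simp: cap_def disjnt_def)

lemma same_block_cap:
  assumes "u \<noteq> v"
  shows "(u, v) \<in> same_block (cap X p q) \<longleftrightarrow> {u, v} = {Inl p, Inl q}"
  using assms by (auto simp: same_block_def cap_def)

lemma cap_in_partial_Brauer_monoid:
  assumes "p \<in> X" "q \<in> X"
  shows "cap X p q \<in> carrier (partial_Brauer_monoid X)"
  using partition_on_cap[OF assms] card_insert_le_m1[of 2 "{Inl q}" "Inl p"]
  by (auto simp: partial_Brauer_monoid_simps cap_def)

text \<open>The block of \<open>p\<close> and \<open>q\<close> survives only if neither of its two vertices is isolated.\<close>

lemma partial_id_mult_cap: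
  assumes A: "A \<subseteq> X" and pq: "p \<in> X" "q \<in> X" "p \<noteq> q"
  shows "partition_product X (partial_id X A) (cap X p q) =
    (if {p, q} \<subseteq> A then cap X p q else partial_id X {})"
proof (cases "{p, q} \<subseteq> A")
  case True
  then have "partition_product X (partial_id X A) (cap X p q) = cap X p q"
    by (intro partial_id_product A partition_on_cap pq)
      (auto simp: same_block_cap doubleton_eq_iff)
  then show ?thesis using True by simp
next
  case False
  then have "partition_product X (partial_id X A) (cap X p q) = partial_id X {}"
    by (intro partial_id_product A partition_on_cap partition_on_partial_id pq)
      (auto simp: same_block_cap same_block_partial_id doubleton_eq_iff)
  then show ?thesis using False by auto
qed

lemma cap_neq_partial_id_empty:
  assumes "p \<noteq> q"
  shows "cap X p q \<noteq> partial_id X {}"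
proof
  assume "cap X p q = partial_id X {}"
  moreover have "(Inl p, Inl q) \<in> same_block (cap X p q)"
    using assms by (simp add: same_block_cap)
  ultimately show False using assms by (simp add: same_block_partial_id)
qed

lemma not_left_Ehresmann_partial_Brauer_monoid:
  assumes pq: "p \<in> X" "q \<in> X" "p \<noteq> q"
  shows "\<not> left_Ehresmann (partial_Brauer_monoid X) {partial_id X A | A. A \<subseteq> X}"
    (is "\<not> left_Ehresmann ?S ?E")
proof
  assume "left_Ehresmann ?S ?E"
  then have cong: "(a \<otimes>\<^bsub>?S\<^esub> x, a \<otimes>\<^bsub>?S\<^esub> y) \<in> R_rel ?S ?E"
    if "a \<in> carrier ?S" "(x, y) \<in> R_rel ?S ?E" for a x y
    using that unfolding left_Ehresmann_def by blast
  have "cap X p q = partition_product X (partial_id X A) (cap X p q) \<longleftrightarrow>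
      partial_id X {p, q} = partition_product X (partial_id X A) (partial_id X {p, q})"
    if A: "A \<subseteq> X" for A
  proof -
    have "cap X p q = partition_product X (partial_id X A) (cap X p q) \<longleftrightarrow> {p, q} \<subseteq> A"
      using partial_id_mult_cap[OF A pq] cap_neq_partial_id_empty[OF pq(3), of X] by auto
    moreover have "partial_id X {p, q} = partial_id X (A \<inter> {p, q}) \<longleftrightarrow> {p, q} = A \<inter> {p, q}"
      using A pq by (intro partial_id_eq_iff) auto
    moreover have "partition_product X (partial_id X A) (partial_id X {p, q}) =
        partial_id X (A \<inter> {p, q})"
      using A pq by (intro partial_id_mult) auto
    ultimately show ?thesis
      by (metis inf.absorb_iff2)
  qed
  then have "left_identities ?S ?E (cap X p q) = left_identities ?S ?E (partial_id X {p, q})"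
    by (auto simp: left_identities_def partial_Brauer_monoid_simps(1))
  then have "(cap X p q, partial_id X {p, q}) \<in> R_rel ?S ?E"
    using pq by (simp add: R_rel_def cap_in_partial_Brauer_monoid partial_id_in_partial_Brauer_monoid)
  moreover have "partial_id X {p} \<in> carrier ?S"
    using pq by (simp add: partial_id_in_partial_Brauer_monoid)
  ultimately have "(partial_id X {p} \<otimes>\<^bsub>?S\<^esub> cap X p q, partial_id X {p} \<otimes>\<^bsub>?S\<^esub> partial_id X {p, q})
      \<in> R_rel ?S ?E"
    by (intro cong)
  moreover have "partial_id X {p} \<otimes>\<^bsub>?S\<^esub> cap X p q = partial_id X {}"
    using partial_id_mult_cap[of "{p}" X p q] pq by (auto simp: partial_Brauer_monoid_simps(1))
  moreover have "partial_id X {p} \<otimes>\<^bsub>?S\<^esub> partial_id X {p, q} = partial_id X {p}"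
    using partial_id_mult[of "{p}" X "{p, q}"] pq by (simp add: partial_Brauer_monoid_simps(1))
  ultimately have eq: "left_identities ?S ?E (partial_id X {}) = left_identities ?S ?E (partial_id X {p})"
    by (simp add: R_rel_def)
  have "partial_id X {} \<in> left_identities ?S ?E (partial_id X {})"
    by (auto simp: left_identities_def partial_Brauer_monoid_simps(1) partial_id_mult)
  then have "partial_id X {} \<in> left_identities ?S ?E (partial_id X {p})"
    using eq by simp
  then have "partial_id X {p} = partial_id X {}"
    using pq by (simp add: left_identities_def partial_Brauer_monoid_simps(1) partial_id_mult)
  then show False using partial_id_eq_iff[of "{p}" X "{}"] pq by simp
qed

theorem mainTheorem8:
  fixes X :: "'a set" and E :: "('a + 'a) set set set"
  assumes "infinite X \<or> card X \<ge> 2"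
    and "E = idempotents (symmetric_inverse_monoid X)"
  shows "E = {partial_id X A | A. A \<subseteq> X} \<and>
    semilattice_in (partial_Brauer_monoid X) E \<and>
    \<not> Ehresmann (partial_Brauer_monoid X) E"
proof -
  have E: "E = {partial_id X A | A. A \<subseteq> X}"
    using assms(2) by (simp add: idempotents_symmetric_inverse_monoid)
  obtain T where "T \<subseteq> X" "card T = 2"
    using assms(1) infinite_arbitrarily_large obtain_subset_with_card_n by metis
  then obtain p q where "p \<in> X" "q \<in> X" "p \<noteq> q"
    by (auto simp: card_2_iff)
  then show ?thesis
    using semilattice_in_partial_Brauer_monoid[of X] not_left_Ehresmann_partial_Brauer_monoid[of p X q]
    unfolding E Ehresmann_def by blast
qed

end
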